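(* Let $G=(I_k\mid R)$ be a systematic generator matrix of an $[n,k]_q$ code $C$ whose non-zero weights are contained in $\{i\Delta : a\le i\le b\}\subseteq\mathbb{N}_{\ge 1}$. For every point $P\in\mathcal{P}_k$ let $c(P)$ be the number of columns of $G$ whose span equals $P$, and let $r\ge 1$ be an integer. Let $\mathcal{S}(G)$ be the set of all solutions $(x,y)$, $x=(x_P)_{P\in\mathcal{P}_{k+1}}$, $y=(y_H)_{H\in\mathcal{H}_{k+1}}$, of the system $$\Delta y_H+\sum_{P\in\mathcal{P}_{k+1}:\,P\le H}x_P=n+r-a\Delta\quad\forall H\in\mathcal{H}_{k+1},$$ $$\sum_{t\in\mathbb{F}_q}x_{\langle (u|t)\rangle}=c(\langle u\rangle)\quad\forall \langle u\rangle\in\mathcal{P}_k,\qquad x_{\langle e_{k+1}\rangle}=r,$$ $$x_{\langle e_i\rangle}\ge 1\quad\forall\, 1\le i\le k+1,\qquad x_P\in\mathbb{N}=\{0,1,2,\dots\}\quad\forall P\in\mathcal{P}_{k+1},\qquad y_H\in\{0,\dots,b-a\}\quad\forall H\in\mathcal{H}_{k+1},$$ where $e_i$ is the $i$-th unit vector of $\mathbb{F}_q^{k+1}$ and $(u|t)\in\mathbb{F}_q^{k+1}$ is $u$ with the additional last entry $t$. Then for every systematic generator matrix of the form $$G'=\begin{pmatrix} I_k & 0\cdots 0 & R\\ 0 & \underbrace{1\cdots 1}_{r} & \star\end{pmatrix}$$ (i.e. whose first $k$ rows coincide with $G$ up to $r$ inserted zero columns) of an $[n+r,k+1]_q$ code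 $C'$ all of whose non-zero codewords have weights in $\{i\Delta: a\le i\le b\}$, there is a solution $(x,y)\in\mathcal{S}(G)$ such that, for each $P\in\mathcal{P}_{k+1}$, the matrix $G'$ has exactly $x_P$ columns whose span equals $P$.
   Context: $q$ is a prime power; $a,b,\Delta$ are integers with $1\le a\le b$ and $\Delta\ge 1$. An $[n,k]_q$ code is a $k$-dimensional subspace of $\mathbb{F}_q^n$; it is assumed throughout that its length is its effective length, i.e. no coordinate is zero in all codewords (so generator matrices have no zero column). A generator matrix is systematic if its first columns form a unit matrix. $\mathcal{P}_k$ denotes the set of points of $\mathrm{PG}(k-1,\mathbb{F}_q)$, i.e. the 1-dimensional subspaces of $\mathbb{F}_q^k$, and $\mathcal{H}_k$ the set of hyperplanes, i.e. the $(k-1)$-dimensional subspaces of $\mathbb{F}_q^k$; $P\le H$ means containment. $\langle v\rangle$ is the 1-dimensional subspace spanned by a non-zero vector $v$. The system's second condition does not depend on the representative $u$ of $\langle u\rangle$. *)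

theory Defs
  imports "Jordan_Normal_Form.VS_Connect" "HOL-Library.FuncSet"
begin

text \<open>The field with \<open>q\<close> elements is a type of sort \<open>{field, finite}\<close>.
  Subspaces of its \<open>m\<close>-th power are sets of vectors in \<open>carrier_vec m\<close>.\<close>

definition subspaces :: "nat \<Rightarrow> nat \<Rightarrow> 'a::field vec set set" where
  "subspaces m d = {W. subspace class_ring W (module_vec TYPE('a) m) \<and>
     vectorspace.dim class_ring ((module_vec TYPE('a) m)\<lparr>carrier := W\<rparr>) = d}"

definition points :: "nat \<Rightarrow> 'a::field vec set set" where
  "points m = subspaces m 1"

definition hyperplanes :: "nat \<Rightarrow> 'a::field vec set set" where
  "hyperplanes m = {H. \<exists>d. d + 1 = m \<and> H \<in> subspaces m d}"

definition line_span :: "nat \<Rightarrow> 'a::field vec \<Rightarrow> 'a vec set" where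
  "line_span m v = LinearCombinations.module.span class_ring (module_vec TYPE('a) m) {v}"

text \<open>An \<open>[n,k]\<close> code whose length is its effective length.\<close>

definition linear_code :: "nat \<Rightarrow> nat \<Rightarrow> 'a::field vec set \<Rightarrow> bool" where
  "linear_code n k C \<longleftrightarrow> C \<in> subspaces n k \<and> (\<forall>i<n. \<exists>c\<in>C. c $ i \<noteq> 0)"

definition generator_matrix :: "nat \<Rightarrow> nat \<Rightarrow> 'a::field mat \<Rightarrow> 'a vec set \<Rightarrow> bool" where
  "generator_matrix n k G C \<longleftrightarrow> G \<in> carrier_mat k n \<and> vec_space.row_space n G = C"

definition systematic :: "'a::field mat \<Rightarrow> bool" where
  "systematic G \<longleftrightarrow> dim_row G \<le> dim_col G \<and> (\<forall>i<dim_row G. col G i = unit_vec (dim_row G) i)"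

definition weight :: "'a::zero vec \<Rightarrow> nat" where
  "weight v = card {i. i < dim_vec v \<and> v $ i \<noteq> 0}"

definition weights_in :: "'a::zero vec set \<Rightarrow> nat set \<Rightarrow> bool" where
  "weights_in C W \<longleftrightarrow> (\<forall>c\<in>C. c \<noteq> 0\<^sub>v (dim_vec c) \<longrightarrow> weight c \<in> W)"

definition append_cols :: "'a::zero mat \<Rightarrow> 'a mat \<Rightarrow> 'a mat" (infixr \<open>@\<^sub>c\<close> 65) where
  "A @\<^sub>c B = four_block_mat A B (0\<^sub>m 0 (dim_col A)) (0\<^sub>m 0 (dim_col B))"

definition column_multiplicity :: "'a::field mat \<Rightarrow> 'a vec set \<Rightarrow> nat" where
  "column_multiplicity G P = card {j. j < dim_col G \<and> line_span (dim_row G) (col G j) = P}"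

text \<open>The solution set \<open>S(G)\<close>. The families \<open>x\<close> and \<open>y\<close> are extensional functions, so that
  they carry no data outside of their index sets. The first system of equations is
  stated over the integers, as its right-hand side may be negative. Unit vectors are indexed
  from \<open>0\<close>, hence \<open>unit_vec (k + 1) k\<close> is the last one.\<close>

definition solutions ::
  "nat \<Rightarrow> nat \<Rightarrow> nat \<Rightarrow> nat \<Rightarrow> 'a::{field,finite} mat
    \<Rightarrow> (('a vec set \<Rightarrow> nat) \<times> ('a vec set \<Rightarrow> nat)) set" where
  "solutions a b \<Delta> r G = (let k = dim_row G; n = dim_col G in
    {(x, y).
      x \<in> points (k + 1) \<rightarrow>\<^sub>E UNIV \<and>
      y \<in> hyperplanes (k + 1) \<rightarrow>\<^sub>E {0..b - a} \<and>
      (\<forall>H\<in>hyperplanes (k + 1).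
        int \<Delta> * int (y H) + (\<Sum>P\<in>{P\<in>points (k + 1). P \<subseteq> H}. int (x P))
          = int n + int r - int a * int \<Delta>) \<and>
      (\<forall>u\<in>carrier_vec k. u \<noteq> 0\<^sub>v k \<longrightarrow>
        (\<Sum>t\<in>UNIV. x (line_span (k + 1) (u @\<^sub>v vec 1 (\<lambda>_. t))))
          = column_multiplicity G (line_span k u)) \<and>
      x (line_span (k + 1) (unit_vec (k + 1) k)) = r \<and>
      (\<forall>i<k + 1. x (line_span (k + 1) (unit_vec (k + 1) i)) \<ge> 1)})"

end

theory Submission
  imports Defs
begin

text \<open>Take \<open>x\<^sub>P\<close> to be the number of columns of \<open>G'\<close> on \<open>P\<close>. A hyperplane \<open>H\<close> with normal vector
  \<open>h\<close> contains exactly the columns at which the non-zero codeword \<open>h G'\<close> vanishes, so if this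
  codeword has weight \<open>i \<Delta>\<close>, then \<open>y\<^sub>H = i - a\<close> solves the equation of \<open>H\<close>. Deleting the last
  entry maps the columns of \<open>G'\<close> on the \<open>q\<close> points \<open>\<langle>(u|t)\<rangle>\<close> onto the columns of \<open>G\<close> on \<open>\<langle>u\<rangle>\<close>;
  the \<open>r\<close> inserted columns are the only ones it sends to zero.\<close>

section \<open>Points and subspaces as sets of vectors\<close>

lemma finite_carrier_vec: "finite (carrier_vec m :: 'a::finite vec set)"
proof -
  have "carrier_vec m \<subseteq> (vec_of_list ` {xs :: 'a list. set xs \<subseteq> UNIV \<and> length xs = m})"
  proof
    fix v :: "'a vec" assume "v \<in> carrier_vec m"
    then show "v \<in> vec_of_list ` {xs :: 'a list. set xs \<subseteq> UNIV \<and> length xs = m}"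
      by (intro image_eqI[of _ _ "list_of_vec v"]) (auto simp: vec_list)
  qed
  then show ?thesis
    by (rule finite_subset) (intro finite_imageI finite_lists_length_eq finite)
qed

lemma subspaces_subset: "W \<in> subspaces m d \<Longrightarrow> W \<subseteq> carrier_vec m"
  unfolding subspaces_def subspace_def submodule_def by (auto simp: module_vec_simps)

lemma subspaces_smult:
  "W \<in> subspaces m d \<Longrightarrow> v \<in> W \<Longrightarrow> c \<cdot>\<^sub>v v \<in> (W :: 'a::field vec set)"
  unfolding subspaces_def subspace_def submodule_def by (auto simp: module_vec_simps)

lemma finite_points: "finite (points m :: 'a::{field,finite} vec set set)"
proof (rule finite_subset)
  show "points m \<subseteq> Pow (carrier_vec m :: 'a vec set)"
    unfolding points_def using subspaces_subset by blast
qed (simp add: finite_carrier_vec)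

lemma line_span_eq:
  fixes v :: "'a::field vec"
  assumes "v \<in> carrier_vec m"
  shows "line_span m v = range (\<lambda>c. c \<cdot>\<^sub>v v)"
proof -
  interpret vec_space "TYPE('a)" m .
  have "line_span m v = {lincomb a {v} |a. a \<in> {v} \<rightarrow> UNIV}"
    unfolding line_span_def using assms by (subst finite_span) auto
  moreover have "lincomb a {v} = a v \<cdot>\<^sub>v v" for a
    unfolding lincomb_def using assms by (simp add: finsum_insert)
  ultimately show ?thesis
    by (auto intro: exI[of _ "\<lambda>_. _"])
qed

text \<open>Zero vectors are allowed: if both vanish, \<open>c = 1\<close> is a witness. Columns of
  \<open>G'\<close> truncated to their first \<open>k\<close> entries can thus be compared with
  \<open>u\<close> even where the truncation is zero.\<close>

lemma line_span_eq_iff: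
  fixes v w :: "'a::field vec"
  assumes v: "v \<in> carrier_vec m" and w: "w \<in> carrier_vec m"
  shows "line_span m v = line_span m w \<longleftrightarrow> (\<exists>c. c \<noteq> 0 \<and> w = c \<cdot>\<^sub>v v)"
proof
  assume *: "line_span m v = line_span m w"
  have "w \<in> line_span m w"
    unfolding line_span_eq[OF w] by (intro range_eqI[of _ _ 1]) simp
  then obtain c where c: "w = c \<cdot>\<^sub>v v"
    unfolding *[symmetric] line_span_eq[OF v] by auto
  have "v \<in> line_span m v"
    unfolding line_span_eq[OF v] by (intro range_eqI[of _ _ 1]) simp
  then obtain d where d: "v = d \<cdot>\<^sub>v w"
    unfolding * line_span_eq[OF w] by auto
  show "\<exists>c. c \<noteq> 0 \<and> w = c \<cdot>\<^sub>v v"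
  proof (cases "c = 0")
    case True
    then have "w = 0\<^sub>v m" using c v by auto
    moreover from this have "v = 0\<^sub>v m" using d v by auto
    ultimately show ?thesis by (intro exI[of _ 1]) simp
  qed (use c in blast)
next
  assume "\<exists>c. c \<noteq> 0 \<and> w = c \<cdot>\<^sub>v v"
  then obtain c where c: "c \<noteq> 0" "w = c \<cdot>\<^sub>v v" by blast
  have "d \<cdot>\<^sub>v v = (d / c) \<cdot>\<^sub>v w" for d using c by (simp add: smult_smult_assoc)
  then show "line_span m v = line_span m w"
    unfolding line_span_eq[OF v] line_span_eq[OF w]
    using c(2) by (fastforce simp: smult_smult_assoc)
qed

lemma line_span_subset_iff:
  assumes "W \<in> subspaces m d" and "v \<in> carrier_vec m"
  shows "line_span m v \<subseteq> W \<longleftrightarrow> v \<in> W"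
proof
  assume "line_span m v \<subseteq> W"
  moreover have "1 \<cdot>\<^sub>v v \<in> line_span m v" unfolding line_span_eq[OF assms(2)] by blast
  ultimately show "v \<in> W" by auto
qed (auto simp: line_span_eq[OF assms(2)] subspaces_smult[OF assms(1)])

lemma line_span_in_points:
  fixes v :: "'a::field vec"
  assumes v: "v \<in> carrier_vec m" and nz: "v \<noteq> 0\<^sub>v m"
  shows "line_span m v \<in> points m"
proof -
  interpret vec_space "TYPE('a)" m .
  have sub: "subspace class_ring (span {v}) V"
    using v by (intro span_is_subspace) auto
  interpret W: vectorspace class_ring "vs (span {v})"
    by (rule subspace_is_vs[OF sub])
  have vin: "v \<in> span {v}" using v span_self by auto
  have "W.dim = 1"
  proof (rule W.dim1I[of v])
    show "LinearCombinations.module.span class_ring (vs (span {v})) {v} = carrier (vs (span {v}))"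
      using span_li_not_depend(1)[of "{v}" "span {v}"] vin is_module[OF sub] by simp
  qed (use v nz vin in \<open>auto simp: module_vec_simps\<close>)
  then show ?thesis
    unfolding points_def subspaces_def line_span_def using sub by simp
qed

section \<open>Hyperplanes as kernels of linear forms\<close>

text \<open>The vector \<open>h\<close> serves later as a coefficient vector: it turns the
  containment of a column in \<open>H\<close> into the vanishing of one entry of a codeword.\<close>

lemma hyperplane_normal_vector:
  fixes H :: "'a::{field,finite} vec set"
  assumes "H \<in> hyperplanes m"
  obtains h where "h \<in> carrier_vec m" and "h \<noteq> 0\<^sub>v m"
    and "H = {v \<in> carrier_vec m. v \<bullet> h = 0}"
proof -
  interpret vec_space "TYPE('a)" m .
  from assms obtain d where d: "d + 1 = m" and Hd: "H \<in> subspaces m d"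
    unfolding hyperplanes_def by blast
  then have sub: "subspace class_ring H V" and dimH: "vectorspace.dim class_ring (vs H) = d"
    unfolding subspaces_def by auto
  have Hc: "H \<subseteq> carrier_vec m" by (rule subspaces_subset[OF Hd])
  have finH: "finite H" by (rule finite_subset[OF Hc finite_carrier_vec])
  interpret W: vectorspace class_ring "vs H" by (rule subspace_is_vs[OF sub])
  \<comment> \<open>Over a finite field \<open>H\<close> is finite, so \<open>H\<close> itself is a
    finite generating set.\<close>
  have "W.fin_dim"
    unfolding W.fin_dim_def using finH W.in_own_span[of H] W.span_is_subset2[of H]
    by (intro exI[of _ H]) auto
  then obtain B where finB: "finite B" and B: "W.basis B"
    using W.finite_basis_exists by blast
  have cardB: "card B = d" using W.dim_basis[OF finB B] dimH by simp
  have BH: "B \<subseteq> H" using B unfolding W.basis_def by simp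
  then have Bc: "B \<subseteq> carrier_vec m" using Hc by blast
  have liB: "lin_indpt B" and spanB: "span B = H"
    using B span_li_not_depend[OF BH is_module[OF sub]] unfolding W.basis_def by auto
  from finB obtain bs where bs: "set bs = B" "distinct bs"
    using finite_distinct_list by blast
  then have lbs: "length bs = d" using cardB distinct_card by metis
  \<comment> \<open>A basis of \<open>H\<close> padded with a zero row is a singular square matrix; its kernel contains \<open>h\<close>.\<close>
  define A where "A = mat_of_rows m (bs @ [0\<^sub>v m])"
  have A: "A \<in> carrier_mat m m" unfolding A_def using lbs d by auto
  have rowA: "row A i = (bs @ [0\<^sub>v m]) ! i" if "i < m" for i
    unfolding A_def using that lbs d Bc bs
    by (intro mat_of_rows_row) (auto simp: nth_append)
  \<comment> \<open>Since \<open>d + 1 = m\<close>, the padded zero row is the last row of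
    \<open>A\<close> and has index \<open>d\<close>; \<open>unit_vec m d\<close> selects it.\<close>
  have "A\<^sup>T *\<^sub>v unit_vec m d = 0\<^sub>v m"
  proof -
    have "A\<^sup>T *\<^sub>v unit_vec m d = row A d"
      using A d by (intro eq_vecI) (auto simp: row_def)
    then show ?thesis using rowA[of d] lbs d by (simp add: nth_append)
  qed
  then have "det A\<^sup>T = 0"
    using A d det_0_iff_vec_prod_zero[of "A\<^sup>T" m] by (auto intro!: exI[of _ "unit_vec m d"])
  then have "det A = 0" using det_transpose[OF A] by simp
  then obtain h where h: "h \<in> carrier_vec m" "h \<noteq> 0\<^sub>v m" and Ah: "A *\<^sub>v h = 0\<^sub>v m"
    using det_0_iff_vec_prod_zero[OF A] by blast
  have Bh: "b \<bullet> h = 0" if "b \<in> B" for b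
  proof -
    from that bs lbs obtain i where i: "i < d" "bs ! i = b"
      by (metis in_set_conv_nth)
    have "(A *\<^sub>v h) $ i = row A i \<bullet> h" using A i d by auto
    then show ?thesis using Ah rowA[of i] i d lbs by (simp add: nth_append)
  qed
  \<comment> \<open>Stated for a general \<open>S\<close> because it is applied twice: to
    \<open>B\<close>, which spans \<open>H\<close>, and to \<open>B\<close> with one more vector,
    which spans the whole space.\<close>
  have orth: "x \<bullet> h = 0" if "S \<subseteq> carrier_vec m" "\<And>s. s \<in> S \<Longrightarrow> s \<bullet> h = 0" "x \<in> span S" for S x
  proof -
    have "h \<in> orthogonal_complement S"
      unfolding orthogonal_complement_def
      using that h(1) comm_scalar_prod[OF h(1)] by (auto simp: subset_eq)
    then have "h \<in> orthogonal_complement (span S)" using that(1) by simp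
    then have "h \<bullet> x = 0" unfolding orthogonal_complement_def using that(3) by auto
    then show ?thesis
      using comm_scalar_prod[OF h(1), of x] span_closed[OF that(1,3)] by simp
  qed
  \<comment> \<open>A vector outside \<open>H\<close> extends \<open>B\<close> to a basis of the
    whole space. If it were orthogonal to \<open>h\<close>, then so would be every unit vector,
    which forces \<open>h\<close> to be zero.\<close>
  have "v \<in> H" if v: "v \<in> carrier_vec m" and vh: "v \<bullet> h = 0" for v
  proof (rule ccontr)
    assume "v \<notin> H"
    then have vB: "v \<notin> B" "v \<notin> span B" using BH spanB by auto
    have "lin_indpt (B \<union> {v})"
      using lin_dep_iff_in_span[of B v] Bc liB v vB by auto
    moreover have "card (B \<union> {v}) = m" using vB finB cardB d by simp
    ultimately have "basis (B \<union> {v})"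
      using Bc v finB dim_is_n by (intro dim_li_is_basis) auto
    then have full: "span (B \<union> {v}) = carrier_vec m" unfolding basis_def by simp
    have "h $ i = 0" if i: "i < m" for i
    proof -
      have "unit_vec m i \<bullet> h = 0"
        by (rule orth[of "B \<union> {v}"]) (use Bc v Bh vh full in auto)
      then show ?thesis using h(1) i by simp
    qed
    then show False using h by auto
  qed
  moreover have "v \<bullet> h = 0" if "v \<in> H" for v
    using orth[OF Bc Bh, of v] that spanB by auto
  ultimately show thesis using that[OF h] Hc by blast
qed

section \<open>Counting columns and weights of codewords\<close>

text \<open>Fibres over different values are disjoint. With \<open>f\<close> sending a column index
  to the span of that column, this serves both systems of equations: \<open>S\<close> consists of
  the points in a hyperplane, or of the points extending a given one.\<close>

lemma sum_card_fibres:
  assumes "finite J" and "finite S"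
  shows "(\<Sum>P\<in>S. card {j. j \<in> J \<and> f j = P}) = card {j. j \<in> J \<and> f j \<in> S}"
proof -
  have "{j. j \<in> J \<and> f j \<in> S} = (\<Union>P\<in>S. {j. j \<in> J \<and> f j = P})" by blast
  then show ?thesis
    using assms by (simp add: card_UN_disjoint disjoint_iff)
qed

lemma codeword_index:
  assumes "G \<in> carrier_mat k n" and "h \<in> carrier_vec k" and "j < n"
  shows "(G\<^sup>T *\<^sub>v h) $ j = col G j \<bullet> h"
  using assms by simp

lemma generator_matrix_codewords:
  assumes "generator_matrix n k G (C :: 'a::field vec set)"
  shows "C = (\<lambda>h. G\<^sup>T *\<^sub>v h) ` carrier_vec k"
proof -
  interpret vec_space "TYPE('a)" n .
  from assms have G: "G \<in> carrier_mat k n" and "row_space G = C"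
    unfolding generator_matrix_def by auto
  then show ?thesis using row_space_eq[OF G] G
    by (auto intro!: mult_mat_vec_carrier)
qed

text \<open>A zero column would give a coordinate vanishing in all codewords. It must be excluded
  because it lies in every hyperplane but spans no point, so a sum of multiplicities over points
  would miss it.\<close>

lemma effective_length_col_nonzero:
  assumes "linear_code n k C" and "generator_matrix n k G C" and j: "j < n"
  shows "col G j \<noteq> 0\<^sub>v k"
proof
  assume z: "col G j = 0\<^sub>v k"
  have G: "G \<in> carrier_mat k n" using assms(2) unfolding generator_matrix_def by simp
  from assms(1) j obtain c where "c \<in> C" "c $ j \<noteq> 0" unfolding linear_code_def by blast
  then obtain h where "h \<in> carrier_vec k" "(G\<^sup>T *\<^sub>v h) $ j \<noteq> 0"
    unfolding generator_matrix_codewords[OF assms(2)] by auto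
  then show False using codeword_index[OF G _ j] z by simp
qed

text \<open>A non-zero column spans exactly one point, and this point lies in \<open>W\<close> iff
  the column does.\<close>

lemma column_multiplicity_sum_subspace:
  fixes G :: "'a::{field,finite} mat"
  assumes G: "G \<in> carrier_mat m n" and nz: "\<And>j. j < n \<Longrightarrow> col G j \<noteq> 0\<^sub>v m"
    and W: "W \<in> subspaces m d"
  shows "(\<Sum>P\<in>{P\<in>points m. P \<subseteq> W}. column_multiplicity G P) = card {j. j < n \<and> col G j \<in> W}"
proof -
  have "(\<Sum>P\<in>{P\<in>points m. P \<subseteq> W}. column_multiplicity G P)
      = (\<Sum>P\<in>{P\<in>points m. P \<subseteq> W}. card {j. j \<in> {..<n} \<and> line_span m (col G j) = P})"
    unfolding column_multiplicity_def using G by simp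
  also have "\<dots> = card {j. j \<in> {..<n} \<and> line_span m (col G j) \<in> {P\<in>points m. P \<subseteq> W}}"
    by (rule sum_card_fibres) (simp_all add: finite_points)
  also have "{j. j \<in> {..<n} \<and> line_span m (col G j) \<in> {P\<in>points m. P \<subseteq> W}}
      = {j. j < n \<and> col G j \<in> W}"
    using line_span_in_points[OF _ nz] line_span_subset_iff[OF W] G
    by (intro Collect_cong) (metis (no_types, lifting) carrier_matD(1) col_dim lessThan_iff mem_Collect_eq)
  finally show ?thesis .
qed

text \<open>The columns in \<open>H\<close> are the zero positions of the codeword with coefficient
  vector \<open>h\<close>, a normal vector of \<open>H\<close>; the weight \<open>w\<close> counts
  the other positions.\<close>

lemma systematic_hyperplane_weight:
  fixes G :: "'a::{field,finite} mat"
  assumes "generator_matrix n m G C" and "systematic G"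
    and "weights_in C W" and H: "H \<in> hyperplanes m"
  shows "\<exists>w\<in>W. card {j. j < n \<and> col G j \<in> H} + w = n"
proof -
  from H obtain h where h: "h \<in> carrier_vec m" "h \<noteq> 0\<^sub>v m"
    and Heq: "H = {v \<in> carrier_vec m. v \<bullet> h = 0}"
    by (rule hyperplane_normal_vector)
  have G: "G \<in> carrier_mat m n" using assms(1) unfolding generator_matrix_def by simp
  define c where "c = G\<^sup>T *\<^sub>v h"
  have cj: "c $ j = col G j \<bullet> h" if "j < n" for j
    unfolding c_def using codeword_index[OF G h(1) that] .
  have dimc: "dim_vec c = n" using G unfolding c_def by simp
  have "c \<in> C" unfolding generator_matrix_codewords[OF assms(1)] c_def using h(1) by blast
  \<comment> \<open>The leading unit columns make the first \<open>m\<close> entries of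
    \<open>c\<close> equal to those of \<open>h\<close>, which is not zero.\<close>
  moreover have "c \<noteq> 0\<^sub>v n"
  proof
    assume c0: "c = 0\<^sub>v n"
    have "h $ i = 0" if "i < m" for i
    proof -
      have "i < n" "col G i = unit_vec m i"
        using that assms(2) G unfolding systematic_def by auto
      then show ?thesis using cj[of i] c0 that h(1) by simp
    qed
    then show False using h by auto
  qed
  ultimately have "weight c \<in> W" using assms(3) dimc unfolding weights_in_def by auto
  moreover have "card {j. j < n \<and> col G j \<in> H} + weight c = n"
  proof -
    have "{j. j < n \<and> col G j \<in> H} = {j. j < n \<and> c $ j = 0}"
      using cj G unfolding Heq by auto
    then have "card {j. j < n \<and> col G j \<in> H} + weight c
        = card ({j. j < n \<and> c $ j = 0} \<union> {j. j < n \<and> c $ j \<noteq> 0})"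
      unfolding weight_def dimc by (subst card_Un_disjoint) auto
    also have "{j. j < n \<and> c $ j = 0} \<union> {j. j < n \<and> c $ j \<noteq> 0} = {..<n}" by auto
    finally show ?thesis by simp
  qed
  ultimately show ?thesis by blast
qed

section \<open>Deleting the last coordinate of a point\<close>

lemma append_one_carrier_vec: "u \<in> carrier_vec k \<Longrightarrow> u @\<^sub>v vec 1 (\<lambda>_. t) \<in> carrier_vec (k + 1)"
  by (intro append_carrier_vec) auto

lemma append_one_eq_smult_iff:
  fixes u w :: "'a::field vec"
  assumes "u \<in> carrier_vec k" and "w \<in> carrier_vec k"
  shows "u @\<^sub>v vec 1 (\<lambda>_. t) = c \<cdot>\<^sub>v (w @\<^sub>v vec 1 (\<lambda>_. z)) \<longleftrightarrow> u = c \<cdot>\<^sub>v w \<and> t = c * z"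
proof -
  have "c \<cdot>\<^sub>v (w @\<^sub>v vec 1 (\<lambda>_. z)) = (c \<cdot>\<^sub>v w) @\<^sub>v vec 1 (\<lambda>_. c * z)"
    using assms by (intro eq_vecI) auto
  moreover have "vec 1 (\<lambda>_. t) = vec 1 (\<lambda>_. c * z) \<longleftrightarrow> t = c * z"
    by (auto simp: vec_eq_iff)
  ultimately show ?thesis
    using assms append_vec_eq[of u k "c \<cdot>\<^sub>v w"] by simp
qed

lemma line_span_append_one_eq_iff:
  fixes u w :: "'a::field vec"
  assumes "u \<in> carrier_vec k" and "w \<in> carrier_vec k"
  shows "line_span (k + 1) (w @\<^sub>v vec 1 (\<lambda>_. z)) = line_span (k + 1) (u @\<^sub>v vec 1 (\<lambda>_. t))
    \<longleftrightarrow> (\<exists>c. c \<noteq> 0 \<and> u = c \<cdot>\<^sub>v w \<and> t = c * z)"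
  using assms by (simp only: line_span_eq_iff append_one_carrier_vec append_one_eq_smult_iff)

text \<open>The points spanned by \<open>(u|t)\<close> are distinct for distinct \<open>t\<close>. A
  column \<open>(w|z)\<close> spans one of them iff \<open>u = c w\<close> for some non-zero
  \<open>c\<close>, and then \<open>t = c z\<close> is the matching last entry.\<close>

lemma sum_column_multiplicity_extensions:
  fixes G :: "'a::{field,finite} mat"
  assumes G: "G \<in> carrier_mat (k + 1) N"
    and col: "\<And>j. j < N \<Longrightarrow> w j \<in> carrier_vec k \<and> col G j = w j @\<^sub>v vec 1 (\<lambda>_. z j)"
    and u: "u \<in> carrier_vec k" "u \<noteq> 0\<^sub>v k"
  shows "(\<Sum>t\<in>UNIV. column_multiplicity G (line_span (k + 1) (u @\<^sub>v vec 1 (\<lambda>_. t))))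
    = card {j. j < N \<and> line_span k (w j) = line_span k u}"
proof -
  define L where "L t = line_span (k + 1) (u @\<^sub>v vec 1 (\<lambda>_. t))" for t
  have "inj L"
  proof
    fix t t' assume "L t = L t'"
    then obtain c where c: "u = c \<cdot>\<^sub>v u" "t' = c * t"
      unfolding L_def line_span_append_one_eq_iff[OF u(1) u(1)] by blast
    \<comment> \<open>Comparing a non-zero entry of \<open>u\<close> in \<open>u = c u\<close>
      forces \<open>c = 1\<close>.\<close>
    from u obtain i where i: "i < k" "u $ i \<noteq> 0" by (metis eq_vecI carrier_vecD index_zero_vec)
    from c(1) have "u $ i = c * u $ i" using i u(1) by (metis carrier_vecD index_smult_vec(1))
    then show "t = t'" using c(2) i by simp
  qed
  have "(\<Sum>t\<in>UNIV. column_multiplicity G (L t)) = (\<Sum>P\<in>range L. column_multiplicity G P)"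
    using \<open>inj L\<close> by (simp add: sum.reindex)
  also have "\<dots> = (\<Sum>P\<in>range L. card {j. j \<in> {..<N} \<and> line_span (k + 1) (col G j) = P})"
    unfolding column_multiplicity_def using G by simp
  also have "\<dots> = card {j. j \<in> {..<N} \<and> line_span (k + 1) (col G j) \<in> range L}"
    by (rule sum_card_fibres) simp_all
  also have "{j. j \<in> {..<N} \<and> line_span (k + 1) (col G j) \<in> range L}
      = {j. j < N \<and> line_span k (w j) = line_span k u}"
  proof -
    have "line_span (k + 1) (col G j) \<in> range L \<longleftrightarrow> line_span k (w j) = line_span k u"
      if "j \<in> {..<N}" for j
    proof -
      have wj: "w j \<in> carrier_vec k" and "col G j = w j @\<^sub>v vec 1 (\<lambda>_. z j)"
        using col that by auto
      then show ?thesis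
        unfolding L_def image_iff line_span_eq_iff[OF wj u(1)]
        using line_span_append_one_eq_iff[OF u(1) wj] by auto
    qed
    then show ?thesis by auto
  qed
  finally show ?thesis unfolding L_def .
qed

section \<open>The solution read off from the columns of \<open>G'\<close>\<close>

theorem lemma7:
  fixes a b \<Delta> n k r :: nat
    and G R G' s :: "'a::{field,finite} mat"
    and C C' :: "'a vec set"
  assumes "1 \<le> a" and "a \<le> b" and "1 \<le> \<Delta>" and "1 \<le> r"
    and "linear_code n k C"
    and "generator_matrix n k G C"
    and "systematic G"
    and "R \<in> carrier_mat k (n - k)"
    and "G = 1\<^sub>m k @\<^sub>c R"
    and "weights_in C {i * \<Delta> |i. a \<le> i \<and> i \<le> b}"
    and "linear_code (n + r) (k + 1) C'"
    and "generator_matrix (n + r) (k + 1) G' C'"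
    and "systematic G'"
    and "s \<in> carrier_mat 1 (n - k)"
    and "G' = four_block_mat
                (1\<^sub>m k)   (0\<^sub>m k r @\<^sub>c R)
                (0\<^sub>m 1 k) (mat 1 r (\<lambda>_. 1) @\<^sub>c s)"
    and "weights_in C' {i * \<Delta> |i. a \<le> i \<and> i \<le> b}"
  shows "\<exists>(x, y) \<in> solutions a b \<Delta> r G.
           \<forall>P\<in>points (k + 1). column_multiplicity G' P = x P"
proof -
  have G: "G \<in> carrier_mat k n" and G': "G' \<in> carrier_mat (k + 1) (n + r)"
    using assms(6,12) unfolding generator_matrix_def by auto
  have kn: "k \<le> n" using assms(7) G unfolding systematic_def by auto
  \<comment> \<open>\<open>p\<close> sends the index of a column of \<open>G\<close> to its index in
    \<open>G'\<close>, jumping over the inserted block \<open>k..<k + r\<close>; \<open>w j\<close>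
    and \<open>z j\<close> split column \<open>j\<close> of \<open>G'\<close> into its first
    \<open>k\<close> entries and its last one.\<close>
  define p where "p j = (if j < k then j else j + r)" for j
  define w where "w j = vec k (\<lambda>i. G' $$ (i, j))" for j
  define z where "z j = G' $$ (k, j)" for j
  have w: "w j \<in> carrier_vec k" for j unfolding w_def by simp
  have colG': "col G' j = w j @\<^sub>v vec 1 (\<lambda>_. z j)" if "j < n + r" for j
    using G' that unfolding w_def z_def by (intro eq_vecI) (auto simp: less_Suc_eq)
  have w_new: "w j = 0\<^sub>v k" and z_new: "z j = 1" if "k \<le> j" "j < k + r" for j
    using that assms(8,14,15) kn unfolding w_def z_def append_cols_def by auto
  have w_old: "w (p j) = col G j" if "j < n" for j
    using that assms(8,9,14,15) kn G unfolding w_def p_def append_cols_def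
    by (intro eq_vecI) auto
  have p_lt: "p j < n + r" if "j < n" for j using that unfolding p_def by simp
  have p_range: "j \<in> p ` {..<n}" if "j < n + r" "\<not> (k \<le> j \<and> j < k + r)" for j
  proof (cases "j < k")
    case True
    then show ?thesis using kn by (intro image_eqI[of _ _ j]) (auto simp: p_def)
  next
    case False
    then show ?thesis using that by (intro image_eqI[of _ _ "j - r"]) (auto simp: p_def)
  qed
  have inj_p: "inj p" unfolding p_def inj_def by auto
  have colG_nz: "col G j \<noteq> 0\<^sub>v k" if "j < n" for j
    by (rule effective_length_col_nonzero[OF assms(5,6) that])
  have colG'_nz: "col G' j \<noteq> 0\<^sub>v (k + 1)" if "j < n + r" for j
    by (rule effective_length_col_nonzero[OF assms(11,12) that])
  have unit_point: "line_span (k + 1) (unit_vec (k + 1) i :: 'a vec) \<in> points (k + 1)"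
    if "i < k + 1" for i :: nat
    using that by (intro line_span_in_points) auto

  define X where "X H = card {j. j < n + r \<and> col G' j \<in> H}" for H
  define x where "x = restrict (column_multiplicity G') (points (k + 1))"
  \<comment> \<open>\<open>n + r - X H\<close> is the weight of a codeword belonging to
    \<open>H\<close>, hence some \<open>i * \<Delta>\<close> with \<open>i\<close> at least
    \<open>a\<close>; neither subtraction nor the division loses anything.\<close>
  define y where "y = restrict (\<lambda>H. (n + r - X H) div \<Delta> - a) (hyperplanes (k + 1))"
  have xP: "x P = column_multiplicity G' P" if "P \<in> points (k + 1)" for P
    using that unfolding x_def by simp
  \<comment> \<open>With \<open>a * \<Delta>\<close> moved to the left, the equation lives in the
    natural numbers and carries over to the integers.\<close>
  have y: "y H \<le> b - a \<and> \<Delta> * y H + X H + a * \<Delta> = n + r"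
    if H: "H \<in> hyperplanes (k + 1)" for H
  proof -
    from systematic_hyperplane_weight[OF assms(12,13,16) H]
    obtain i where i: "a \<le> i" "i \<le> b" "X H + i * \<Delta> = n + r"
      unfolding X_def by auto
    then have "n + r - X H = i * \<Delta>" by simp
    then have "y H = i - a" using H assms(3) unfolding y_def by simp
    moreover have "\<Delta> * (i - a) + a * \<Delta> = i * \<Delta>"
      using i(1) by (metis add_mult_distrib le_add_diff_inverse2 mult.commute)
    ultimately show ?thesis using i by auto
  qed
  have hyp: "int \<Delta> * int (y H) + (\<Sum>P\<in>{P\<in>points (k + 1). P \<subseteq> H}. int (x P))
      = int n + int r - int a * int \<Delta>" if H: "H \<in> hyperplanes (k + 1)" for H
  proof -
    from H obtain d where d: "H \<in> subspaces (k + 1) d" unfolding hyperplanes_def by blast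
    have "(\<Sum>P\<in>{P\<in>points (k + 1). P \<subseteq> H}. x P)
        = (\<Sum>P\<in>{P\<in>points (k + 1). P \<subseteq> H}. column_multiplicity G' P)"
      by (intro sum.cong) (auto simp: xP)
    also have "\<dots> = X H"
      unfolding X_def by (rule column_multiplicity_sum_subspace[OF G' _ d]) (rule colG'_nz)
    finally have "(\<Sum>P\<in>{P\<in>points (k + 1). P \<subseteq> H}. x P) = X H" .
    then have "(\<Sum>P\<in>{P\<in>points (k + 1). P \<subseteq> H}. int (x P)) = int (X H)"
      by (metis of_nat_sum)
    moreover have "int (\<Delta> * y H + X H + a * \<Delta>) = int (n + r)" using y[OF H] by simp
    ultimately show ?thesis by simp
  qed
  have ext: "(\<Sum>t\<in>UNIV. x (line_span (k + 1) (u @\<^sub>v vec 1 (\<lambda>_. t))))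
      = column_multiplicity G (line_span k u)"
    if u: "u \<in> carrier_vec k" "u \<noteq> 0\<^sub>v k" for u
  proof -
    have "line_span (k + 1) (u @\<^sub>v vec 1 (\<lambda>_. t)) \<in> points (k + 1)" for t
    proof (rule line_span_in_points)
      show "u @\<^sub>v vec 1 (\<lambda>_. t) \<noteq> 0\<^sub>v (k + 1)"
        using u append_one_eq_smult_iff[OF u(1) zero_carrier_vec, of t 0 0]
        by (auto simp: vec_eq_iff)
    qed (rule append_one_carrier_vec[OF u(1)])
    then have "(\<Sum>t\<in>UNIV. x (line_span (k + 1) (u @\<^sub>v vec 1 (\<lambda>_. t))))
        = card {j. j < n + r \<and> line_span k (w j) = line_span k u}"
      using sum_column_multiplicity_extensions[OF G' _ u, of w z] w colG' by (simp add: xP)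
    also have "{j. j < n + r \<and> line_span k (w j) = line_span k u}
        = p ` {j. j < n \<and> line_span k (col G j) = line_span k u}" (is "?A = ?B")
    proof
      show "?B \<subseteq> ?A" using p_lt w_old by auto
      show "?A \<subseteq> ?B"
      proof
        fix j assume j: "j \<in> ?A"
        \<comment> \<open>An inserted column has \<open>w j\<close> zero, and no multiple of zero is
          the non-zero \<open>u\<close>. Every other index is in the image of
          \<open>p\<close>.\<close>
        have "\<not> (k \<le> j \<and> j < k + r)"
          using j u w_new[of j] line_span_eq_iff[OF w u(1), of j] by auto
        with j p_range obtain i where "i < n" "j = p i" by blast
        then show "j \<in> ?B" using j w_old by auto
      qed
    qed
    also have "card \<dots> = column_multiplicity G (line_span k u)"
      unfolding column_multiplicity_def using G inj_p
      by (subst card_image) (auto intro: inj_on_subset)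
    finally show ?thesis .
  qed
  have last: "x (line_span (k + 1) (unit_vec (k + 1) k)) = r"
  proof -
    have e: "unit_vec (k + 1) k = 0\<^sub>v k @\<^sub>v vec 1 (\<lambda>_. 1 :: 'a)"
      by (intro eq_vecI) auto
    have at_last: "line_span (k + 1) (col G' j) = line_span (k + 1) (unit_vec (k + 1) k)
        \<longleftrightarrow> k \<le> j \<and> j < k + r" if j: "j < n + r" for j
    proof (cases "k \<le> j \<and> j < k + r")
      case True
      then show ?thesis using w_new z_new colG'[OF j] e by simp
    next
      case False
      \<comment> \<open>Outside the inserted block, \<open>w j\<close> is a column of
        \<open>G\<close> and therefore non-zero, so column \<open>j\<close> cannot span the last
        unit point. This bounds the multiplicity by \<open>r\<close>.\<close>
      with j p_range obtain i where "i < n" "j = p i" by blast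
      then have "w j \<noteq> 0\<^sub>v k" using w_old colG_nz by simp
      then have "0\<^sub>v k \<noteq> c \<cdot>\<^sub>v w j" if "c \<noteq> 0" for c
        using that w[of j] by (auto simp: vec_eq_iff)
      then show ?thesis
        unfolding colG'[OF j] e line_span_append_one_eq_iff[OF zero_carrier_vec w]
        using False by blast
    qed
    have "{j. j < n + r \<and> line_span (k + 1) (col G' j) = line_span (k + 1) (unit_vec (k + 1) k)}
        = {j. j < n + r \<and> k \<le> j \<and> j < k + r}"
      using at_last by (intro Collect_cong) blast
    also have "\<dots> = {k..<k + r}" using kn by auto
    finally have "{j. j < n + r \<and> line_span (k + 1) (col G' j) = line_span (k + 1) (unit_vec (k + 1) k)}
        = {k..<k + r}" .
    then show ?thesis
      using xP[OF unit_point[of k]] G' unfolding column_multiplicity_def by simp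
  qed
  have unit: "x (line_span (k + 1) (unit_vec (k + 1) i)) \<ge> 1" if i: "i < k + 1" for i
  proof -
    let ?J = "{j. j < n + r \<and> line_span (k + 1) (col G' j) = line_span (k + 1) (unit_vec (k + 1) i)}"
    \<comment> \<open>Column \<open>i\<close> of \<open>G'\<close> is the unit vector itself; for
      \<open>i = k\<close> it is the first inserted column.\<close>
    have "i \<in> ?J" using i assms(13) G' unfolding systematic_def by auto
    then have "1 \<le> card ?J" using card_gt_0_iff[of ?J] by fastforce
    then show ?thesis
      using xP[OF unit_point[OF i]] G' unfolding column_multiplicity_def by simp
  qed
  have "x \<in> points (k + 1) \<rightarrow>\<^sub>E UNIV" unfolding x_def by auto
  moreover have "y \<in> hyperplanes (k + 1) \<rightarrow>\<^sub>E {0..b - a}"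
    using y unfolding y_def by (auto simp: PiE_def)
  ultimately have "(x, y) \<in> solutions a b \<Delta> r G"
    unfolding solutions_def Let_def using G hyp ext last unit by auto
  then show ?thesis using xP by (intro bexI[of _ "(x, y)"]) simp_all
qed

end
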